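(* Fix $\delta,\beta\in(0,1)$, $\eta>0$ and $K\ge1$. Let $\mathbb{P}$ be a probability distribution supported on $[a,b]\subset\mathbb{R}$ with a density $f$ satisfying $\inf_{x\in[a,b]}f(x)\ge m>0$, and let $$r_K(\beta)=\frac1m\sqrt{\frac{\ln(2/\beta)}{2K}}.$$ Let $R^{(1)},\ldots,R^{(K)}$ be i.i.d. with distribution $\mathbb{P}$ and let $R^{(0)}$ be an independent random variable with distribution $\mathbb{P}_{\mathrm{test}}$, where $W_\infty(\mathbb{P},\mathbb{P}_{\mathrm{test}})\le\eta$. Define $$\bar\alpha_{\mathrm{DRO}}:=\mathrm{Quantile}_{1-\delta}(R^{(1)},\ldots,R^{(K)})+r_K(\beta),\qquad \bar\alpha_{\mathrm{DRO}}^{\mathrm{test}}:=\bar\alpha_{\mathrm{DRO}}+\eta.$$ Then $$\mathbb{P}^K\Bigl(\mathbb{P}_{\mathrm{test}}\bigl(R^{(0)}\le\bar\alpha_{\mathrm{DRO}}^{\mathrm{test}}\bigr)\ge1-\delta\Bigr)\ge1-\beta,$$ where the inner probability is over $R^{(0)}\sim\mathbb{P}_{\mathrm{test}}$ with the calibration samples fixed and the outer one is over $R^{(1)},\ldots,R^{(K)}$.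
   Context: $\mathbb{P}^K=\mathbb{P}^{\otimes K}$. $\mathbb{P}$ and $\mathbb{P}_{\mathrm{test}}$ are Borel probability measures on $\mathcal{X}\subseteq\mathbb{R}$. For values $a_1,\ldots,a_n$ and $p\in(0,1)$, $\mathrm{Quantile}_p(a_1,\ldots,a_n)$ is the $\lceil np\rceil$-th smallest of them. $W_\infty(\mathbb{P}_1,\mathbb{P}_2):=\inf_{\pi\in\Gamma(\mathbb{P}_1,\mathbb{P}_2)}\sup_{(x_1,x_2)\in\operatorname{supp}(\pi)}|x_1-x_2|$, where $\Gamma(\mathbb{P}_1,\mathbb{P}_2)$ is the set of couplings of $\mathbb{P}_1$ and $\mathbb{P}_2$. *)

theory Defs
  imports "HOL-Probability.Probability"
begin

text \<open>Topological support, for a measure on the subspace Borel sigma-algebra of its carrier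
  \<open>space M\<close>, which may be a proper subset of the type.\<close>

definition measure_support :: "'a::topological_space measure \<Rightarrow> 'a set" where
  "measure_support M =
     {x \<in> space M. \<forall>U. open U \<longrightarrow> x \<in> U \<longrightarrow> emeasure M (U \<inter> space M) > 0}"

definition couplings :: "'a measure \<Rightarrow> 'b measure \<Rightarrow> ('a \<times> 'b) measure set" where
  "couplings P Q =
     {\<pi>. prob_space \<pi> \<and> sets \<pi> = sets (P \<Otimes>\<^sub>M Q) \<and> distr \<pi> P fst = P \<and> distr \<pi> Q snd = Q}"

text \<open>The distance is \<open>ennreal\<close>-valued, since it is infinite when every coupling has
  unbounded displacement.\<close>

definition W_infinity :: "real measure \<Rightarrow> real measure \<Rightarrow> ennreal" where
  "W_infinity P Q =
     (INF \<pi>\<in>couplings P Q. SUP z\<in>measure_support \<pi>. ennreal \<bar>fst z - snd z\<bar>)"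

text \<open>The \<open>\<lceil>n p\<rceil>\<close>-th smallest of \<open>n\<close> values, counted with multiplicity; the shift by one is
  due to zero-based list indexing. Meaningful for nonempty lists and \<open>0 < p \<le> 1\<close>.\<close>

definition quantile :: "real \<Rightarrow> real list \<Rightarrow> real" where
  "quantile p xs = sort xs ! (nat \<lceil>real (length xs) * p\<rceil> - 1)"

definition conf_radius :: "real \<Rightarrow> nat \<Rightarrow> real \<Rightarrow> real" where
  "conf_radius m K \<beta> = (1 / m) * sqrt (ln (2 / \<beta>) / (2 * real K))"

definition alpha_DRO :: "real \<Rightarrow> real \<Rightarrow> real \<Rightarrow> nat \<Rightarrow> (nat \<Rightarrow> real) \<Rightarrow> real" where
  "alpha_DRO m \<delta> \<beta> K R = quantile (1 - \<delta>) (map R [1..<Suc K]) + conf_radius m K \<beta>"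

definition alpha_DRO_test ::
    "real \<Rightarrow> real \<Rightarrow> real \<Rightarrow> real \<Rightarrow> nat \<Rightarrow> (nat \<Rightarrow> real) \<Rightarrow> real" where
  "alpha_DRO_test m \<delta> \<beta> \<eta> K R = alpha_DRO m \<delta> \<beta> K R + \<eta>"

end

theory Submission
  imports Defs
begin

text \<open>
  Write \<open>F\<close> and \<open>G\<close> for the distribution functions of \<open>P\<close> and \<open>Ptest\<close>, \<open>r\<close> for the confidence
  radius and \<open>Q\<close> for the empirical \<open>(1 - \<delta>)\<close>-quantile of the sample. Two facts combine.

  Shift: a coupling whose displacement is almost surely at most \<open>c\<close> sends the event that the first
  coordinate is at most \<open>t\<close> into the event that the second is at most \<open>t + c\<close>. Couplings of
  displacement at most \<open>c\<close> exist for every \<open>c > \<eta>\<close>, and right continuity of \<open>G\<close> passes to the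
  limit, so \<open>F t \<le> G (t + \<eta>)\<close>, whether or not the infimum defining \<open>W_infinity\<close> is attained
  (\<open>W_infinity_cdf_le\<close>).

  Concentration: since \<open>P\<close> has a density, \<open>F\<close> is continuous and \<open>F q = 1 - \<delta>\<close> for some \<open>q\<close> in
  \<open>{a..b}\<close>. If \<open>Q \<ge> q - r\<close>, then \<open>F (Q + r) \<ge> 1 - \<delta>\<close>, and the shift gives
  \<open>G (Q + r + \<eta>) \<ge> 1 - \<delta>\<close>. If \<open>Q < q - r\<close>, then at least a fraction \<open>1 - \<delta>\<close> of the sample lies
  below \<open>q - r\<close>. If \<open>q - r < a\<close>, this almost never happens; otherwise the half-line below \<open>q - r\<close>
  has \<open>P\<close>-mass at most \<open>1 - \<delta> - m r\<close>, because the density is at least \<open>m\<close> on \<open>{q - r..q}\<close>.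
  Hoeffding's inequality then bounds the probability by \<open>exp (- 2 K (m r)\<^sup>2) = \<beta> / 2\<close>
  (\<open>quantile_lower_tail_le\<close>).

  All distribution functions are taken for the image measure under the identity into the Borel sets
  of the line, because the carrier of \<open>P\<close> may be any subset of the reals, Borel or not.
\<close>

section \<open>Couplings and distribution functions\<close>

text \<open>Every point outside the support has a null open neighbourhood, and by the Lindelof property
  countably many of these already cover the complement of the support. Measurability of the identity
  expresses that the traces of open sets on the carrier are events.\<close>

lemma AE_in_measure_support:
  fixes M :: "'a::second_countable_topology measure"
  assumes id [measurable]: "(\<lambda>x. x) \<in> borel_measurable M"
  shows "AE x in M. x \<in> measure_support M"
proof -
  define \<U> where "\<U> = {U. open U \<and> emeasure M (U \<inter> space M) = 0}"
  obtain \<V> where \<V>: "\<V> \<subseteq> \<U>" "countable \<V>" "\<Union>\<V> = \<Union>\<U>"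
    using Lindelof[of \<U>] by (auto simp: \<U>_def)
  have "U \<inter> space M \<in> null_sets M" if "U \<in> \<V>" for U
  proof (rule null_setsI)
    show "emeasure M (U \<inter> space M) = 0"
      using that \<V>(1) by (auto simp: \<U>_def)
    have "(\<lambda>x. x) -` U \<inter> space M \<in> sets M"
      using that \<V>(1) by (intro measurable_sets[OF id]) (auto simp: \<U>_def)
    then show "U \<inter> space M \<in> sets M"
      by simp
  qed
  then have "(\<Union>U\<in>\<V>. U \<inter> space M) \<in> null_sets M"
    using \<V>(2) by (intro null_sets_UN') auto
  moreover have "{x \<in> space M. x \<notin> measure_support M} \<subseteq> (\<Union>U\<in>\<V>. U \<inter> space M)"
  proof
    fix x assume "x \<in> {x \<in> space M. x \<notin> measure_support M}"
    then have "x \<in> space M" "x \<in> \<Union>\<U>"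
      by (auto simp: measure_support_def \<U>_def not_less)
    then show "x \<in> (\<Union>U\<in>\<V>. U \<inter> space M)"
      using \<V>(3) by auto
  qed
  ultimately show ?thesis
    by (rule AE_I')
qed

lemma coupling_displacement_cdf_le:
  fixes P Q :: "real measure"
  assumes P: "(\<lambda>x. x) \<in> borel_measurable P" and Q: "(\<lambda>x. x) \<in> borel_measurable Q"
    and \<pi>: "\<pi> \<in> couplings P Q"
    and sup: "(SUP z\<in>measure_support \<pi>. ennreal \<bar>fst z - snd z\<bar>) \<le> ennreal c" and "0 \<le> c"
  shows "cdf (distr P borel (\<lambda>x. x)) t \<le> cdf (distr Q borel (\<lambda>x. x)) (t + c)"
proof -
  from \<pi> have "prob_space \<pi>" and sets: "sets \<pi> = sets (P \<Otimes>\<^sub>M Q)"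
    and dP: "distr \<pi> P fst = P" and dQ: "distr \<pi> Q snd = Q"
    by (auto simp: couplings_def)
  interpret prob_space \<pi> by fact
  have mP: "fst \<in> \<pi> \<rightarrow>\<^sub>M P" and mQ: "snd \<in> \<pi> \<rightarrow>\<^sub>M Q"
    by (simp_all add: measurable_cong_sets[OF sets])
  have f [measurable]: "fst \<in> borel_measurable \<pi>" and s [measurable]: "snd \<in> borel_measurable \<pi>"
    using measurable_compose[OF mP P] measurable_compose[OF mQ Q] by simp_all
  have "(\<lambda>z. (fst z, snd z)) \<in> borel_measurable \<pi>"
    by measurable
  then have "AE z in \<pi>. z \<in> measure_support \<pi>"
    by (intro AE_in_measure_support) simp
  then have close: "AE z in \<pi>. \<bar>fst z - snd z\<bar> \<le> c"
  proof eventually_elim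
    case (elim z)
    then have "ennreal \<bar>fst z - snd z\<bar> \<le> ennreal c"
      by (intro order_trans[OF SUP_upper sup])
    then show ?case
      using \<open>0 \<le> c\<close> by simp
  qed
  have margP: "distr P borel (\<lambda>x. x) = distr \<pi> borel fst"
    by (subst dP[symmetric], subst distr_distr[OF P mP]) (simp add: comp_def)
  have margQ: "distr Q borel (\<lambda>x. x) = distr \<pi> borel snd"
    by (subst dQ[symmetric], subst distr_distr[OF Q mQ]) (simp add: comp_def)
  have "prob {z \<in> space \<pi>. fst z \<le> t} \<le> prob {z \<in> space \<pi>. snd z \<le> t + c}"
    using close by (intro finite_measure_mono_AE) (auto elim!: eventually_mono)
  then show ?thesis
    by (simp add: margP margQ cdf_def measure_distr vimage_def Int_def conj_commute)
qed

text \<open>An optimal coupling need not be available, so the bound is first obtained at every point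
  to the right of \<open>t + \<eta>\<close> and then carried to \<open>t + \<eta>\<close> by right continuity.\<close>

lemma W_infinity_cdf_le:
  fixes P Q :: "real measure"
  assumes P: "(\<lambda>x. x) \<in> borel_measurable P" and Q: "(\<lambda>x. x) \<in> borel_measurable Q"
    and "prob_space Q" and W: "W_infinity P Q \<le> ennreal \<eta>" and "0 \<le> \<eta>"
  shows "cdf (distr P borel (\<lambda>x. x)) t \<le> cdf (distr Q borel (\<lambda>x. x)) (t + \<eta>)"
proof -
  interpret Q: prob_space Q by fact
  interpret D: real_distribution "distr Q borel (\<lambda>x. x)"
    using Q by (rule Q.real_distribution_distr)
  have "cdf (distr P borel (\<lambda>x. x)) t \<le> cdf (distr Q borel (\<lambda>x. x)) y" if "t + \<eta> < y" for y
  proof -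
    have "W_infinity P Q < ennreal (y - t)"
      using W that \<open>0 \<le> \<eta>\<close> by (elim le_less_trans) (simp add: ennreal_lessI)
    then obtain \<pi> where "\<pi> \<in> couplings P Q"
      "(SUP z\<in>measure_support \<pi>. ennreal \<bar>fst z - snd z\<bar>) < ennreal (y - t)"
      unfolding W_infinity_def INF_less_iff by blast
    with coupling_displacement_cdf_le[OF P Q, of \<pi> "y - t" t] that \<open>0 \<le> \<eta>\<close> show ?thesis
      by simp
  qed
  then have "\<forall>\<^sub>F y in at_right (t + \<eta>).
      cdf (distr P borel (\<lambda>x. x)) t \<le> cdf (distr Q borel (\<lambda>x. x)) y"
    by (auto simp: eventually_at_filter)
  moreover have "(cdf (distr Q borel (\<lambda>x. x)) \<longlongrightarrow> cdf (distr Q borel (\<lambda>x. x)) (t + \<eta>))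
      (at_right (t + \<eta>))"
    using D.cdf_is_right_cont by (simp add: continuous_within)
  ultimately show ?thesis
    by (intro tendsto_lowerbound) auto
qed

section \<open>Empirical quantiles\<close>

lemma sorted_nth_less_iff:
  fixes xs :: "'a::linorder list"
  assumes "sorted xs" "j < length xs"
  shows "xs ! j < t \<longleftrightarrow> j < length (filter (\<lambda>x. x < t) xs)"
  using assms
proof (induction xs arbitrary: j)
  case (Cons x xs)
  have "filter (\<lambda>x. x < t) xs = []" if "\<not> x < t"
    using Cons.prems(1) that by (auto simp: filter_empty_conv)
  moreover have "xs ! i \<ge> x" if "i < length xs" for i
    using Cons.prems(1) that by auto
  ultimately show ?case
    using Cons by (cases j) (auto simp: not_less intro: order_trans)
qed simp

text \<open>Turns a statement about an order statistic into one about a count. Rounding up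
  \<open>length xs * p\<close> disappears because it is compared with an integer.\<close>

lemma quantile_less_iff:
  assumes "0 < p" "p \<le> 1" "xs \<noteq> []"
  shows "quantile p xs < t \<longleftrightarrow> real (length xs) * p \<le> real (length (filter (\<lambda>x. x < t) xs))"
proof -
  define k where "k = nat \<lceil>real (length xs) * p\<rceil>"
  have "0 < k"
    using assms by (simp add: k_def)
  moreover have "k \<le> length xs"
    using assms by (simp add: k_def nat_le_iff ceiling_le_iff mult_left_le)
  ultimately have "quantile p xs < t \<longleftrightarrow> k - 1 < length (filter (\<lambda>x. x < t) (sort xs))"
    unfolding quantile_def k_def[symmetric] by (intro sorted_nth_less_iff) auto
  also have "\<dots> \<longleftrightarrow> k \<le> length (filter (\<lambda>x. x < t) xs)"
    using \<open>0 < k\<close> by (simp add: filter_sort) linarith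
  also have "\<dots> \<longleftrightarrow> real (length xs) * p \<le> real (length (filter (\<lambda>x. x < t) xs))"
    by (simp add: k_def nat_le_iff ceiling_le_iff)
  finally show ?thesis .
qed

lemma quantile_sample_less_iff:
  assumes "0 < p" "p \<le> 1" "1 \<le> K"
  shows "quantile p (map R [1..<Suc K]) < t \<longleftrightarrow> real K * p \<le> real (card {i \<in> {1..K}. R i < t})"
proof -
  have "length (filter (\<lambda>x. x < t) (map R [1..<Suc K])) = card {i \<in> {1..K}. R i < t}"
    by (subst length_filter_map, subst distinct_length_filter) 
       (auto intro!: arg_cong[where f = card] simp: comp_def)
  then show ?thesis
    using assms by (subst quantile_less_iff) auto
qed

lemma borel_measurable_quantile_sample:
  assumes P: "(\<lambda>x. x) \<in> borel_measurable P" and "0 < p" "p \<le> 1" "1 \<le> K"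
  shows "(\<lambda>R. quantile p (map R [1..<Suc K])) \<in> borel_measurable (PiM {1..K} (\<lambda>_. P))"
  unfolding borel_measurable_iff_less
proof
  fix t :: real
  let ?M = "PiM {1..K} (\<lambda>_. P)"
  have "(\<lambda>R. R i) \<in> borel_measurable ?M" if "i \<in> {1..K}" for i
    using measurable_compose[OF measurable_component_singleton[OF that] P] .
  then have "Measurable.pred ?M (\<lambda>R. R i < t)" if "i \<in> {1..K}" for i
    using that by (intro borel_measurable_pred_less) auto
  then have "(\<lambda>R. \<Sum>i\<in>{1..K}. if R i < t then 1 else 0 :: real) \<in> borel_measurable ?M"
    by (intro borel_measurable_sum measurable_If) auto
  moreover have "real (card {i \<in> {1..K}. R i < t}) = (\<Sum>i\<in>{1..K}. if R i < t then 1 else 0)"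
    for R :: "nat \<Rightarrow> real"
    by (simp add: sum.If_cases Int_def)
  ultimately have "{R \<in> space ?M. real K * p \<le> real (card {i \<in> {1..K}. R i < t})} \<in> sets ?M"
    by simp
  then show "{R \<in> space ?M. quantile p (map R [1..<Suc K]) < t} \<in> sets ?M"
    unfolding quantile_sample_less_iff[OF assms(2-4)] .
qed

section \<open>Concentration\<close>

lemma (in prob_space) indep_vars_PiM_components:
  assumes "I \<noteq> {}"
  shows "prob_space.indep_vars (PiM I (\<lambda>_. M)) (\<lambda>_. M) (\<lambda>i \<omega>. \<omega> i) I"
proof -
  interpret I: prob_space "PiM I (\<lambda>_. M)"
    by (intro prob_space_PiM prob_space_axioms)
  have "distr (PiM I (\<lambda>_. M)) (PiM I (\<lambda>_. M)) (\<lambda>\<omega>. \<lambda>i\<in>I. \<omega> i) = distr (PiM I (\<lambda>_. M)) (PiM I (\<lambda>_. M)) (\<lambda>\<omega>. \<omega>)"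
    by (intro distr_cong) (auto simp: space_PiM)
  also have "\<dots> = PiM I (\<lambda>i. distr (PiM I (\<lambda>_. M)) M (\<lambda>\<omega>. \<omega> i))"
    by (simp, intro PiM_cong refl, subst distr_PiM_component[OF prob_space_axioms]) auto
  finally show ?thesis
    using assms by (subst I.indep_vars_iff_distr_eq_PiM') auto
qed

text \<open>Hoeffding's inequality for the indicators of \<open>A\<close> in the coordinates of a product space:
  they are independent, take values in \<open>{0..1}\<close> and have mean \<open>prob A\<close>.\<close>

lemma (in prob_space) empirical_frequency_tail_le:
  assumes I: "finite I" "I \<noteq> {}" and A [measurable]: "A \<in> sets M" and "0 \<le> \<epsilon>"
  shows "measure (PiM I (\<lambda>_. M))
      {\<omega> \<in> space (PiM I (\<lambda>_. M)). real (card I) * (prob A + \<epsilon>) \<le> real (card {i \<in> I. \<omega> i \<in> A})}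
    \<le> exp (- 2 * real (card I) * \<epsilon>\<^sup>2)"
proof -
  interpret I: prob_space "PiM I (\<lambda>_. M)"
    by (intro prob_space_PiM prob_space_axioms)
  define X where "X i \<omega> = (indicator A (\<omega> i) :: real)" for i :: 'b and \<omega>
  have indep: "I.indep_vars (\<lambda>_. borel) X I"
    unfolding X_def by (rule I.indep_vars_compose2[OF indep_vars_PiM_components]) (use I in auto)
  have mean: "I.expectation (X i) = prob A" if "i \<in> I" for i
  proof -
    have "I.expectation (X i) = (\<integral>x. indicator A x \<partial>distr (PiM I (\<lambda>_. M)) M (\<lambda>\<omega>. \<omega> i))"
      using that unfolding X_def by (subst integral_distr) auto
    also have "\<dots> = prob A"
      using that by (subst distr_PiM_component[OF prob_space_axioms]) auto
    finally show ?thesis .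
  qed
  interpret X: Hoeffding_ineq "PiM I (\<lambda>_. M)" I X "\<lambda>_. 0" "\<lambda>_. 1" "\<Sum>i\<in>I. I.expectation (X i)"
    using I indep by unfold_locales (auto simp: X_def indicator_def)
  have "real (card {i \<in> I. \<omega> i \<in> A}) = (\<Sum>i\<in>I. X i \<omega>)" for \<omega>
    using I by (simp add: X_def indicator_def sum.If_cases Int_def)
  with X.Hoeffding_ineq_ge[of "real (card I) * \<epsilon>"] I \<open>0 \<le> \<epsilon>\<close> show ?thesis
    by (simp add: mean card_gt_0_iff ring_distribs power2_eq_square mult_ac)
qed

lemma distributed_interval_mass_ge:
  fixes f :: "real \<Rightarrow> real"
  assumes "prob_space P" and f: "distributed P lborel (\<lambda>x. x) (\<lambda>x. ennreal (f x))"
    and "c \<le> d" and "0 \<le> m" and "\<And>x. x \<in> {c..d} \<Longrightarrow> m \<le> f x"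
  shows "m * (d - c) \<le> measure (distr P borel (\<lambda>x. x)) {c..d}"
proof -
  interpret prob_space P by fact
  have dens: "distr P borel (\<lambda>x. x) = density lborel (\<lambda>x. ennreal (f x))"
    and [measurable]: "(\<lambda>x. ennreal (f x)) \<in> borel_measurable lborel"
    and id: "(\<lambda>x. x) \<in> borel_measurable P"
    using f by (auto simp: distributed_def cong: distr_cong)
  interpret D: prob_space "distr P borel (\<lambda>x. x)"
    using id by (rule prob_space_distr)
  have "ennreal (m * (d - c)) = (\<integral>\<^sup>+x. ennreal m * indicator {c..d} x \<partial>lborel)"
    using assms by (simp add: nn_integral_cmult_indicator ennreal_mult')
  also have "\<dots> \<le> (\<integral>\<^sup>+x. ennreal (f x) * indicator {c..d} x \<partial>lborel)"
    using assms by (intro nn_integral_mono) (auto simp: indicator_def ennreal_leI)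
  also have "\<dots> = emeasure (distr P borel (\<lambda>x. x)) {c..d}"
    unfolding dens by (simp add: emeasure_density)
  finally show ?thesis
    by (simp add: D.emeasure_eq_measure)
qed

lemma distributed_singleton_null:
  assumes f: "distributed P lborel (\<lambda>x. x) (\<lambda>x::real. ennreal (f x))"
  shows "measure (distr P borel (\<lambda>x. x)) {x} = 0"
proof -
  have dens: "distr P borel (\<lambda>x. x) = density lborel (\<lambda>x. ennreal (f x))"
    and [measurable]: "(\<lambda>x. ennreal (f x)) \<in> borel_measurable lborel"
    using f by (auto simp: distributed_def cong: distr_cong)
  have "emeasure (distr P borel (\<lambda>x. x)) {x} = 0"
    unfolding dens by (auto simp: emeasure_density nn_integral_0_iff_AE indicator_def
       intro!: eventually_mono[OF AE_lborel_singleton[of x]])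
  then show ?thesis
    by (simp add: measure_def)
qed

text \<open>For the empirical quantile to fall below \<open>q - r\<close>, a fraction \<open>p\<close> of the sample has to lie
  there, while the mass there is smaller than \<open>p\<close>, the mass up to \<open>q\<close>, by the mass of
  \<open>{q - r..q}\<close>. The lower bound on the density is only known inside \<open>{a..b}\<close>, hence the case distinction: if \<open>q - r < a\<close>, almost no
  sample has a point below \<open>q - r\<close>.\<close>

lemma quantile_lower_tail_le:
  fixes P :: "real measure"
  assumes "prob_space P" and id: "(\<lambda>x. x) \<in> borel_measurable P"
    and supp: "AE x in P. x \<in> {a..b}"
    and f: "distributed P lborel (\<lambda>x. x) (\<lambda>x. ennreal (f x))"
    and "0 \<le> m" and f_ge: "\<And>x. x \<in> {a..b} \<Longrightarrow> m \<le> f x"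
    and p: "0 < p" "p \<le> 1" and K: "1 \<le> K" and "0 \<le> r"
    and q: "q \<le> b" "cdf (distr P borel (\<lambda>x. x)) q = p"
  shows "measure (PiM {1..K} (\<lambda>_. P))
      {R \<in> space (PiM {1..K} (\<lambda>_. P)). quantile p (map R [1..<Suc K]) < q - r}
    \<le> exp (- 2 * real K * (m * r)\<^sup>2)"
proof -
  interpret P: prob_space P by fact
  interpret D: real_distribution "distr P borel (\<lambda>x. x)"
    using id by (rule P.real_distribution_distr)
  let ?M = "PiM {1..K} (\<lambda>_. P)" and ?A = "{x \<in> space P. x < q - r}"
  interpret M: prob_space ?M
    by (intro prob_space_PiM P.prob_space_axioms)
  have A: "?A \<in> sets P"
    using id unfolding borel_measurable_iff_less by blast
  have count: "quantile p (map R [1..<Suc K]) < q - r \<longleftrightarrow>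
      real K * p \<le> real (card {i \<in> {1..K}. R i \<in> ?A})" if "R \<in> space ?M" for R
  proof -
    have "{i \<in> {1..K}. R i < q - r} = {i \<in> {1..K}. R i \<in> ?A}"
      using that by (auto simp: space_PiM PiE_def Pi_def)
    then show ?thesis
      using quantile_sample_less_iff[OF p K] by simp
  qed
  show ?thesis
  proof (cases "a \<le> q - r")
    case True
    have "P.prob ?A = measure (distr P borel (\<lambda>x. x)) {..<q - r}"
      using id by (simp add: measure_distr vimage_def Int_def conj_commute)
    moreover have "m * (q - (q - r)) \<le> measure (distr P borel (\<lambda>x. x)) {q - r..q}"
      using True \<open>0 \<le> r\<close> \<open>0 \<le> m\<close> \<open>q \<le> b\<close> f_ge
      by (intro distributed_interval_mass_ge[OF \<open>prob_space P\<close> f]) auto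
    moreover have "p = measure (distr P borel (\<lambda>x. x)) ({..<q - r} \<union> {q - r..q})"
      using q \<open>0 \<le> r\<close> by (simp add: cdf_def ivl_disj_un)
    moreover have "measure (distr P borel (\<lambda>x. x)) ({..<q - r} \<union> {q - r..q})
        = measure (distr P borel (\<lambda>x. x)) {..<q - r} + measure (distr P borel (\<lambda>x. x)) {q - r..q}"
      by (intro D.finite_measure_Union) auto
    ultimately have gap: "m * r \<le> p - P.prob ?A"
      by simp
    \<comment> \<open>Hoeffding with the exact gap \<open>p - P.prob ?A\<close>, for which the event is precisely the
      one that \<open>count\<close> describes; the bound is then weakened to the gap \<open>m * r\<close>.\<close>
    have "M.prob {R \<in> space ?M. quantile p (map R [1..<Suc K]) < q - r}
        = M.prob {R \<in> space ?M. real (card {1..K}) * (P.prob ?A + (p - P.prob ?A))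
            \<le> real (card {i \<in> {1..K}. R i \<in> ?A})}"
      using count by (intro arg_cong[where f = M.prob]) auto
    also have "\<dots> \<le> exp (- 2 * real (card {1..K}) * (p - P.prob ?A)\<^sup>2)"
      using A K gap mult_nonneg_nonneg[OF \<open>0 \<le> m\<close> \<open>0 \<le> r\<close>]
      by (intro P.empirical_frequency_tail_le) auto
    also have "\<dots> \<le> exp (- 2 * real K * (m * r)\<^sup>2)"
      using gap mult_nonneg_nonneg[OF \<open>0 \<le> m\<close> \<open>0 \<le> r\<close>] by (auto intro!: mult_left_mono power_mono)
    finally show ?thesis .
  next
    case False
    have "AE R in ?M. \<forall>i\<in>{1..K}. R i \<in> {a..b}"
      by (intro AE_finite_allI AE_PiM_component P.prob_space_axioms supp) auto
    then have "AE R in ?M. \<not> quantile p (map R [1..<Suc K]) < q - r"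
      using AE_space
    proof eventually_elim
      case (elim R)
      then have none: "{i \<in> {1..K}. R i \<in> ?A} = {}"
        using False by force
      show ?case
        using p K unfolding count[OF elim(2)] none by (simp add: not_le)
    qed
    then have "M.prob {R \<in> space ?M. quantile p (map R [1..<Suc K]) < q - r} = 0"
      using borel_measurable_quantile_sample[OF id p K] unfolding borel_measurable_iff_less
      by (subst M.prob_eq_0) auto
    then show ?thesis
      by simp
  qed
qed

text \<open>A distribution with a density has no atoms, so its distribution function is continuous and
  the intermediate value theorem applies between the ends of the support.\<close>

lemma distributed_obtain_quantile:
  fixes P :: "real measure"
  assumes "prob_space P" and id: "(\<lambda>x. x) \<in> borel_measurable P"
    and supp: "AE x in P. x \<in> {a..b}" and "a \<le> b"
    and f: "distributed P lborel (\<lambda>x. x) (\<lambda>x. ennreal (f x))"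
    and p: "0 \<le> p" "p \<le> 1"
  obtains q where "a \<le> q" "q \<le> b" "cdf (distr P borel (\<lambda>x. x)) q = p"
proof -
  interpret P: prob_space P by fact
  interpret D: real_distribution "distr P borel (\<lambda>x. x)"
    using id by (rule P.real_distribution_distr)
  let ?F = "cdf (distr P borel (\<lambda>x. x))"
  have cont: "isCont ?F x" for x
    unfolding D.isCont_cdf using distributed_singleton_null[OF f] .
  have AE_D: "AE x in distr P borel (\<lambda>x. x). x \<in> {a..b}"
    using supp id by (subst AE_distr_iff) auto
  have "D.prob {..a} = D.prob {a}"
    using AE_D by (intro D.finite_measure_eq_AE) (auto elim!: eventually_mono)
  then have "?F a = 0"
    using distributed_singleton_null[OF f] by (simp add: cdf_def)
  moreover have "?F b = 1"
    unfolding cdf_def using AE_D by (subst D.prob_eq_1) (auto elim!: eventually_mono)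
  ultimately have "\<exists>q\<ge>a. q \<le> b \<and> ?F q = p"
    using p \<open>a \<le> b\<close> cont by (intro IVT) auto
  with that show thesis
    by blast
qed

section \<open>The robust quantile bound\<close>

theorem lemma5p3:
  fixes X :: "real set" and P Ptest :: "real measure" and f :: "real \<Rightarrow> real"
    and \<delta> \<beta> \<eta> a b m :: real and K :: nat
  assumes "0 < \<delta>" "\<delta> < 1" and "0 < \<beta>" "\<beta> < 1" and "0 < \<eta>" and "1 \<le> K"
    and "prob_space P" and "sets P = sets (restrict_space borel X)"
    and "prob_space Ptest" and "sets Ptest = sets (restrict_space borel X)"
    and "a \<le> b" and "AE x in P. x \<in> {a..b}"
    and "\<And>x. 0 \<le> f x" and "distributed P lborel (\<lambda>x. x) (\<lambda>x. ennreal (f x))"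
    and "0 < m" and "m \<le> (INF x\<in>{a..b}. f x)"
    and "W_infinity P Ptest \<le> ennreal \<eta>"
  shows "measure (PiM {1..K} (\<lambda>_. P))
           {R \<in> space (PiM {1..K} (\<lambda>_. P)).
              measure Ptest {r \<in> space Ptest. r \<le> alpha_DRO_test m \<delta> \<beta> \<eta> K R} \<ge> 1 - \<delta>}
         \<ge> 1 - \<beta>"
proof -
  interpret P: prob_space P by fact
  interpret T: prob_space Ptest by fact
  have id: "(\<lambda>x. x) \<in> borel_measurable P" "(\<lambda>x. x) \<in> borel_measurable Ptest"
    by (simp_all add: measurable_cong_sets[OF assms(8)] measurable_cong_sets[OF assms(10)]
      measurable_restrict_space1)
  interpret D: real_distribution "distr P borel (\<lambda>x. x)"
    using id(1) by (rule P.real_distribution_distr)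
  interpret DT: real_distribution "distr Ptest borel (\<lambda>x. x)"
    using id(2) by (rule T.real_distribution_distr)
  let ?M = "PiM {1..K} (\<lambda>_. P)"
  let ?F = "cdf (distr P borel (\<lambda>x. x))" and ?FT = "cdf (distr Ptest borel (\<lambda>x. x))"
  interpret M: prob_space ?M
    by (intro prob_space_PiM P.prob_space_axioms)
  define r where "r = conf_radius m K \<beta>"
  define Q where "Q R = quantile (1 - \<delta>) (map R [1..<Suc K])" for R :: "nat \<Rightarrow> real"
  have Q_meas [measurable]: "Q \<in> borel_measurable ?M"
    unfolding Q_def using id(1) assms by (intro borel_measurable_quantile_sample) auto
  have "0 \<le> ln (2 / \<beta>)"
    using assms by (intro ln_ge_zero) (auto simp: field_simps)
  then have "0 \<le> r" and mr: "(m * r)\<^sup>2 = ln (2 / \<beta>) / (2 * real K)"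
    using assms by (auto simp: r_def conf_radius_def)
  have f_ge: "m \<le> f x" if "x \<in> {a..b}" for x
  proof -
    have "bdd_below (f ` {a..b})"
      using assms(13) by (intro bdd_belowI[of _ 0]) auto
    then have "(INF x\<in>{a..b}. f x) \<le> f x"
      using that by (rule cINF_lower)
    with assms(16) show ?thesis
      by simp
  qed
  obtain q where q: "a \<le> q" "q \<le> b" "?F q = 1 - \<delta>"
    using distributed_obtain_quantile[OF \<open>prob_space P\<close> id(1) assms(12) \<open>a \<le> b\<close> assms(14), of "1 - \<delta>"]
      assms by auto
  have good: "1 - \<delta> \<le> ?FT (Q R + r + \<eta>)" if "q - r \<le> Q R" for R
  proof -
    have "1 - \<delta> \<le> ?F (Q R + r)"
      using that by (subst q(3)[symmetric]) (intro D.cdf_nondecreasing, simp)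
    also have "\<dots> \<le> ?FT (Q R + r + \<eta>)"
      using W_infinity_cdf_le[OF id \<open>prob_space Ptest\<close> assms(17)] assms by simp
    finally show ?thesis .
  qed
  \<comment> \<open>A monotone distribution function makes the event in the conclusion measurable; the
    measure of a nonmeasurable set would be the default value 0.\<close>
  have "mono ?FT"
    by (intro monoI DT.cdf_nondecreasing)
  then have [measurable]: "?FT \<in> borel_measurable borel"
    by (rule borel_measurable_mono)
  have success: "{R \<in> space ?M. 1 - \<delta> \<le> ?FT (Q R + r + \<eta>)} \<in> sets ?M"
    and bad: "{R \<in> space ?M. Q R < q - r} \<in> sets ?M"
    by measurable
  have FT_eq: "?FT (Q R + r + \<eta>)
      = measure Ptest {x \<in> space Ptest. x \<le> alpha_DRO_test m \<delta> \<beta> \<eta> K R}" for R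
    using id(2) by (simp add: cdf_def measure_distr vimage_def Int_def conj_commute
      alpha_DRO_test_def alpha_DRO_def Q_def r_def)
  have "M.prob {R \<in> space ?M. Q R < q - r} \<le> exp (- 2 * real K * (m * r)\<^sup>2)"
    unfolding Q_def using id(1) assms q f_ge \<open>0 \<le> r\<close>
    by (intro quantile_lower_tail_le[where a = a and b = b and f = f]) auto
  also have "\<dots> = \<beta> / 2"
    using assms by (simp add: mr exp_minus)
  finally have "1 - \<beta> \<le> 1 - M.prob {R \<in> space ?M. Q R < q - r}"
    using assms by simp
  also have "\<dots> = M.prob {R \<in> space ?M. q - r \<le> Q R}"
    using M.prob_neg[OF bad] by (simp add: not_less)
  also have "\<dots> \<le> M.prob {R \<in> space ?M. 1 - \<delta> \<le> ?FT (Q R + r + \<eta>)}"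
    using good success by (intro M.finite_measure_mono) auto
  finally show ?thesis
    unfolding FT_eq .
qed

end
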